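(* Let $q$ be a prime power and let $m\geq 1$ be an integer. Then there exist a finite commutative ring $R$ with identity and a proper prime ideal $P$ of $R$ such that $|P|=m$ and $|R/P|=q$. Consequently, $$\Gamma_P(R)\cong K_{m-1}\vee \overline{K}_{m(q-1)}.$$
   Context: For a finite commutative ring $R$ with identity and a proper prime ideal $P$, the prime ideal graph $\Gamma_P(R)$ is the simple graph with vertex set $R\setminus\{0\}$ in which two distinct vertices $x,y$ are adjacent if and only if $xy\in P$. $K_a$ is the complete graph on $a$ vertices, $\overline{K}_b$ is the edgeless graph on $b$ vertices ($K_0$ is the graph with no vertices). For vertex-disjoint graphs $G,H$, the join $G\vee H$ is obtained from the disjoint union of $G$ and $H$ by adding all edges between every vertex of $G$ and every vertex of $H$. The symbol $\cong$ denotes graph isomorphism. *)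

theory Defs
  imports
    "HOL-Algebra.QuotRing"
    "HOL-Number_Theory.Prime_Powers"
    "Graph_Theory.Pair_Digraph"
    "Graph_Theory.Digraph_Isomorphism"
begin

text \<open>
  As usual in the Graph Theory library, a finite simple graph is a finite loop-free symmetric
  digraph without parallel arcs (locale \<^locale>\<open>pair_graph\<close>): an edge between \<open>x\<close> and \<open>y\<close> is the
  pair of arcs \<open>(x, y)\<close> and \<open>(y, x)\<close>.
\<close>

definition prime_ideal_graph ::
    "('a, 'b) ring_scheme \<Rightarrow> 'a set \<Rightarrow> 'a pair_pre_digraph" where
  "prime_ideal_graph R P =
    \<lparr> pverts = carrier R - {\<zero>\<^bsub>R\<^esub>},
      parcs = {(x, y). x \<in> carrier R - {\<zero>\<^bsub>R\<^esub>} \<and> y \<in> carrier R - {\<zero>\<^bsub>R\<^esub>} \<and>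
                       x \<noteq> y \<and> x \<otimes>\<^bsub>R\<^esub> y \<in> P} \<rparr>"

definition complete_graph :: "nat \<Rightarrow> nat pair_pre_digraph" where
  "complete_graph n = \<lparr> pverts = {..<n}, parcs = {(i, j). i < n \<and> j < n \<and> i \<noteq> j} \<rparr>"

definition edgeless_graph :: "nat \<Rightarrow> nat pair_pre_digraph" where
  "edgeless_graph n = \<lparr> pverts = {..<n}, parcs = {} \<rparr>"

text \<open>The sum type makes the two vertex sets disjoint.\<close>

definition graph_join ::
    "'a pair_pre_digraph \<Rightarrow> 'b pair_pre_digraph \<Rightarrow> ('a + 'b) pair_pre_digraph" where
  "graph_join G H =
    \<lparr> pverts = pverts G <+> pverts H,
      parcs = {(Inl u, Inl v) | u v. (u, v) \<in> parcs G} \<union>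
              {(Inr u, Inr v) | u v. (u, v) \<in> parcs H} \<union>
              {(Inl u, Inr v) | u v. u \<in> pverts G \<and> v \<in> pverts H} \<union>
              {(Inr v, Inl u) | u v. u \<in> pverts G \<and> v \<in> pverts H} \<rparr>"

definition graph_iso :: "'a pair_pre_digraph \<Rightarrow> 'b pair_pre_digraph \<Rightarrow> bool" where
  "graph_iso G H \<longleftrightarrow> digraph_iso (with_proj G) (with_proj H)"

lemma pair_graphI:
  assumes "finite (pverts G)" "parcs G \<subseteq> pverts G \<times> pverts G"
    and "sym (parcs G)" "\<And>v. (v, v) \<notin> parcs G"
  shows "pair_graph G"
proof
  show "finite (parcs G)"
    using assms(1,2) by (meson finite_SigmaI finite_subset)
qed (use assms in \<open>auto simp: symmetric_def\<close>)

lemma pair_graph_prime_ideal_graph: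
  assumes "cring R" "finite (carrier R)"
  shows "pair_graph (prime_ideal_graph R P)"
  by (rule pair_graphI)
     (use assms in \<open>auto simp: prime_ideal_graph_def sym_def cring.cring_simprules(14)\<close>)

lemma pair_graph_complete_graph: "pair_graph (complete_graph n)"
  by (rule pair_graphI) (auto simp: complete_graph_def sym_def)

lemma pair_graph_edgeless_graph: "pair_graph (edgeless_graph n)"
  by (rule pair_graphI) (auto simp: edgeless_graph_def sym_def)

lemma pair_graph_graph_join:
  assumes "pair_graph G" "pair_graph H"
  shows "pair_graph (graph_join G H)"
proof -
  interpret G: pair_graph G by fact
  interpret H: pair_graph H by fact
  have "sym (parcs G)" "sym (parcs H)"
    using G.pair_sym_arcs H.pair_sym_arcs by (auto simp: symmetric_def)
  then show ?thesis
    by (intro pair_graphI)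
       (auto simp: graph_join_def sym_def dest: G.in_arcsD1 G.in_arcsD2 H.in_arcsD1 H.in_arcsD2
          G.pair_no_loops H.pair_no_loops)
qed

text \<open>Isomorphism as bijection of the vertices preserving and reflecting adjacency.\<close>

lemma graph_iso_iff:
  assumes "pair_graph G" "pair_graph H"
  shows "graph_iso G H \<longleftrightarrow>
    (\<exists>f. bij_betw f (pverts G) (pverts H) \<and>
         (\<forall>u \<in> pverts G. \<forall>v \<in> pverts G. (f u, f v) \<in> parcs H \<longleftrightarrow> (u, v) \<in> parcs G))"
proof -
  interpret G: pair_graph G by fact
  interpret H: pair_graph H by fact
  show ?thesis
  proof
    assume "graph_iso G H"
    then obtain h where h: "pre_digraph.digraph_isomorphism (with_proj G) h"
      and H: "with_proj H = app_iso h (with_proj G)"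
      by (auto simp: graph_iso_def digraph_iso_def)
    let ?f = "iso_verts h"
    have vs: "pverts H = ?f ` pverts G" and as: "parcs H = iso_arcs h ` parcs G"
      and ht: "iso_tail h = fst" "iso_head h = snd"
      using H by (simp_all add: with_proj_def app_iso_def)
    have inj: "inj_on ?f (pverts G)"
      using h by (simp add: pre_digraph.digraph_isomorphism_def)
    have arc: "iso_arcs h (u, v) = (?f u, ?f v)" if "(u, v) \<in> parcs G" for u v
      using h that ht
      by (auto simp: pre_digraph.digraph_isomorphism_def intro!: prod_eqI)
    have "(?f u, ?f v) \<in> parcs H \<longleftrightarrow> (u, v) \<in> parcs G"
      if uv: "u \<in> pverts G" "v \<in> pverts G" for u v
    proof
      assume "(?f u, ?f v) \<in> parcs H"
      then obtain x y where xy: "(x, y) \<in> parcs G" "iso_arcs h (x, y) = (?f u, ?f v)"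
        using as by force
      then have "?f x = ?f u" "?f y = ?f v" "x \<in> pverts G" "y \<in> pverts G"
        using arc[OF xy(1)] by (auto dest: G.in_arcsD1 G.in_arcsD2)
      then show "(u, v) \<in> parcs G"
        using inj uv xy(1) by (metis inj_onD)
    next
      assume "(u, v) \<in> parcs G"
      then show "(?f u, ?f v) \<in> parcs H"
        using as arc by force
    qed
    then show "\<exists>f. bij_betw f (pverts G) (pverts H) \<and>
         (\<forall>u \<in> pverts G. \<forall>v \<in> pverts G. (f u, f v) \<in> parcs H \<longleftrightarrow> (u, v) \<in> parcs G)"
      using inj vs by (auto simp: bij_betw_def intro!: exI[of _ ?f])
  next
    assume "\<exists>f. bij_betw f (pverts G) (pverts H) \<and>
         (\<forall>u \<in> pverts G. \<forall>v \<in> pverts G. (f u, f v) \<in> parcs H \<longleftrightarrow> (u, v) \<in> parcs G)"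
    then obtain f where inj: "inj_on f (pverts G)" and vs: "f ` pverts G = pverts H"
      and adj: "\<And>u v. u \<in> pverts G \<Longrightarrow> v \<in> pverts G \<Longrightarrow> (f u, f v) \<in> parcs H \<longleftrightarrow> (u, v) \<in> parcs G"
      by (auto simp: bij_betw_def)
    define h where "h = \<lparr> iso_verts = f, iso_arcs = map_prod f f, iso_head = snd, iso_tail = fst \<rparr>"
    have "inj_on (map_prod f f) (parcs G)"
      by (rule inj_on_subset[OF map_prod_inj_on[OF inj inj]])
         (auto dest: G.in_arcsD1 G.in_arcsD2)
    then have "pre_digraph.digraph_isomorphism (with_proj G) h"
      using inj G.wf_digraph by (auto simp: pre_digraph.digraph_isomorphism_def h_def)
    moreover have "parcs H = map_prod f f ` parcs G"
    proof (intro equalityI subsetI)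
      fix e assume e: "e \<in> parcs H"
      then have "fst e \<in> f ` pverts G" "snd e \<in> f ` pverts G"
        using vs H.arc_fst_in_verts H.arc_snd_in_verts by auto
      then obtain u v where "u \<in> pverts G" "v \<in> pverts G" "e = (f u, f v)"
        by (metis imageE prod.collapse)
      then show "e \<in> map_prod f f ` parcs G"
        using e adj by force
    next
      fix e assume "e \<in> map_prod f f ` parcs G"
      then show "e \<in> parcs H"
        using adj by (auto dest: G.in_arcsD1 G.in_arcsD2)
    qed
    then have "with_proj H = app_iso h (with_proj G)"
      using vs by (simp add: app_iso_def h_def with_proj_def)
    ultimately show "graph_iso G H"
      by (auto simp: graph_iso_def digraph_iso_def)
  qed
qed

end

theory Submission
  imports
    Defs
    "HOL-Algebra.Algebraic_Closure"
    "HOL-Algebra.Chinese_Remainder"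
    "HOL-Algebra.IntRing"
    "HOL-Number_Theory.Residues"
begin

text \<open>
  Let \<open>F\<close> be a field with \<open>q\<close> elements. In the ring \<open>R = F \<times> \<int>/m\<close> the ideal \<open>P = 0 \<times> \<int>/m\<close>
  has \<open>m\<close> elements, and it is prime as the kernel of the projection onto the domain \<open>F\<close>. By
  Lagrange's theorem \<open>R/P\<close> has \<open>q m / m = q\<close> elements. The shape of the graph follows
  from primality alone (\<open>prime_ideal_graph_iso_join\<close>): the \<open>m - 1\<close> nonzero elements of \<open>P\<close> are
  adjacent to all other vertices, and the \<open>q m - m\<close> elements outside \<open>P\<close> are pairwise
  non-adjacent.

  The substance lies in the existence of \<open>F\<close> (\<open>exists_finite_field\<close>). Let \<open>q = p ^ k\<close>. Over
  some extension \<open>L\<close> of the field of \<open>p\<close> elements the polynomial \<open>X ^ q - X\<close> splits into linear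
  factors. In characteristic \<open>p\<close> the map \<open>x \<mapsto> x ^ q\<close> is additive (\<open>freshmans_dream_power\<close>), so
  its fixed elements in \<open>L\<close>, which are the roots of that polynomial, form a subfield. The roots
  are simple (\<open>alg_mult_frobenius_poly_le\<close>), so there are exactly \<open>q\<close> of them.
\<close>

section \<open>The Frobenius endomorphism\<close>

lemma (in cring) binomial_theorem:
  assumes x: "x \<in> carrier R" and y: "y \<in> carrier R"
  shows "(x \<oplus> y) [^] n = (\<Oplus>k\<in>{..n}. [(n choose k)] \<cdot> (x [^] k \<otimes> y [^] (n - k)))"
proof (induction n)
  case 0
  then show ?case using x y by simp
next
  case (Suc n)
  let ?t = "\<lambda>n k. [(n choose k)] \<cdot> (x [^] k \<otimes> y [^] (n - k))"
  have cl: "?t n k \<in> carrier R" for n k :: nat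
    using x y by simp
  have X: "?t n k \<otimes> x = [(n choose k)] \<cdot> (x [^] Suc k \<otimes> y [^] (n - k))" for k
  proof -
    have "?t n k \<otimes> x = [(n choose k)] \<cdot> (x [^] k \<otimes> y [^] (n - k) \<otimes> x)"
      using x y by (intro add_pow_ldistr) auto
    also have "x [^] k \<otimes> y [^] (n - k) \<otimes> x = x [^] Suc k \<otimes> y [^] (n - k)"
      using x y by (simp add: m_ac)
    finally show ?thesis .
  qed
  have Y: "?t n k \<otimes> y = [(n choose k)] \<cdot> (x [^] k \<otimes> y [^] (Suc n - k))" if "k \<le> n" for k
  proof -
    have "?t n k \<otimes> y = [(n choose k)] \<cdot> (x [^] k \<otimes> y [^] (n - k) \<otimes> y)"
      using x y by (intro add_pow_ldistr) auto
    then show ?thesis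
      using x y that by (simp add: m_ac Suc_diff_le)
  qed
  have pascal: "?t n k \<otimes> x \<oplus> [(n choose Suc k)] \<cdot> (x [^] Suc k \<otimes> y [^] (n - k)) = ?t (Suc n) (Suc k)" for k
    using x y by (simp add: X add.nat_pow_mult del: nat_pow_Suc)
  have "(x \<oplus> y) [^] Suc n = (\<Oplus>k\<in>{..n}. ?t n k) \<otimes> x \<oplus> (\<Oplus>k\<in>{..n}. ?t n k) \<otimes> y"
    using x y cl by (simp add: Suc.IH r_distr Pi_def)
  also have "(\<Oplus>k\<in>{..n}. ?t n k) \<otimes> x = (\<Oplus>k\<in>{..n}. ?t n k \<otimes> x)"
    using x cl by (intro finsum_ldistr) auto
  also have "(\<Oplus>k\<in>{..n}. ?t n k) \<otimes> y = (\<Oplus>k\<in>{..n}. ?t n k \<otimes> y)"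
    using y cl by (intro finsum_ldistr) auto
  also have "(\<Oplus>k\<in>{..n}. ?t n k \<otimes> y) = (\<Oplus>k\<in>{..n}. [(n choose k)] \<cdot> (x [^] k \<otimes> y [^] (Suc n - k)))"
    using x y by (intro finsum_cong') (simp_all add: Y)
  \<comment> \<open>The added top term vanishes, as \<open>n choose Suc n = 0\<close>. It lets the shift by one that
    follows range over the same indices as the sum for \<open>x\<close>, so that Pascal's rule applies termwise.\<close>
  also have "\<dots> = (\<Oplus>k\<in>{..Suc n}. [(n choose k)] \<cdot> (x [^] k \<otimes> y [^] (Suc n - k)))"
    using x y by (subst finsum_Suc) (auto simp: Pi_def binomial_eq_0)
  also have "\<dots> = (\<Oplus>k\<in>{..n}. [(n choose Suc k)] \<cdot> (x [^] Suc k \<otimes> y [^] (n - k))) \<oplus> ?t (Suc n) 0"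
    using x y by (subst finsum_Suc2) (auto simp: Pi_def)
  also have "(\<Oplus>k\<in>{..n}. ?t n k \<otimes> x) \<oplus> \<dots> =
      (\<Oplus>k\<in>{..n}. ?t n k \<otimes> x \<oplus> [(n choose Suc k)] \<cdot> (x [^] Suc k \<otimes> y [^] (n - k))) \<oplus> ?t (Suc n) 0"
    using x y cl by (subst finsum_addf) (auto simp: Pi_def a_assoc)
  also have "\<dots> = (\<Oplus>k\<in>{..Suc n}. ?t (Suc n) k)"
    unfolding pascal using x y by (subst finsum_Suc2) (auto simp: Pi_def)
  finally show ?case .
qed

lemma (in ring_hom_ring) hom_add_nat_pow:
  "x \<in> carrier R \<Longrightarrow> h ([n] \<cdot> x) = [n] \<cdot>\<^bsub>S\<^esub> h x" for n :: nat
  by (induction n) simp_all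

text \<open>
  The inner binomial coefficients of a prime exponent \<open>p\<close> are multiples of \<open>p\<close>, and \<open>p\<close>
  annihilates the ring, so only the two outer terms of the binomial expansion survive.
\<close>

lemma (in cring) freshmans_dream:
  fixes p :: nat
  assumes p: "Factorial_Ring.prime p" and char: "[p] \<cdot> \<one> = \<zero>"
    and x: "x \<in> carrier R" and y: "y \<in> carrier R"
  shows "(x \<oplus> y) [^] p = x [^] p \<oplus> y [^] p"
proof -
  have p0: "0 < p" using p by (simp add: prime_gt_0_nat)
  let ?t = "\<lambda>k. [(p choose k)] \<cdot> (x [^] k \<otimes> y [^] (p - k))"
  have char': "[p] \<cdot> z = \<zero>" if "z \<in> carrier R" for z
    using add_pow_ldistr[OF one_closed that, of p] char that by simp
  have mid: "?t k = \<zero>" if "k \<noteq> 0" "k < p" for k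
  proof -
    from dvd_choose_prime[of k p] that p obtain c where c: "p choose k = p * c"
      by (auto simp: dvd_def)
    have "[(p * c)] \<cdot> (x [^] k \<otimes> y [^] (p - k)) = [c] \<cdot> ([p] \<cdot> (x [^] k \<otimes> y [^] (p - k)))"
      using x y by (simp add: add.nat_pow_pow)
    then show ?thesis using x y by (simp add: char' c)
  qed
  have "(x \<oplus> y) [^] p = (\<Oplus>k\<in>{..p}. ?t k)"
    using x y by (rule binomial_theorem)
  also have "\<dots> = (\<Oplus>k\<in>{0, p}. ?t k)"
    using x y by (intro add.finprod_mono_neutral_cong_right) (auto simp: mid Pi_def)
  also have "\<dots> = x [^] p \<oplus> y [^] p"
    using x y p0 by (simp add: a_comm)
  finally show ?thesis .
qed

lemma (in cring) freshmans_dream_power: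
  fixes p :: nat
  assumes p: "Factorial_Ring.prime p" and char: "[p] \<cdot> \<one> = \<zero>"
    and x: "x \<in> carrier R" and y: "y \<in> carrier R"
  shows "(x \<oplus> y) [^] (p ^ k) = x [^] (p ^ k) \<oplus> y [^] (p ^ k)"
proof (induction k)
  case 0
  then show ?case using x y by simp
next
  case (Suc k)
  have "(x \<oplus> y) [^] (p ^ Suc k) = ((x \<oplus> y) [^] (p ^ k)) [^] p"
    using x y by (simp add: nat_pow_pow mult.commute)
  also have "\<dots> = (x [^] (p ^ k)) [^] p \<oplus> (y [^] (p ^ k)) [^] p"
    unfolding Suc.IH using x y by (intro freshmans_dream p char) auto
  finally show ?case
    using x y by (simp add: nat_pow_pow mult.commute)
qed

text \<open>
  The elements fixed by an endomorphism always form a subring; here the endomorphism is an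
  iterate of the Frobenius map.
\<close>

lemma (in cring) subring_frobenius_fixed:
  fixes p :: nat
  assumes p: "Factorial_Ring.prime p" and char: "[p] \<cdot> \<one> = \<zero>"
  shows "subring {x \<in> carrier R. x [^] (p ^ k) = x} R"
proof (rule subringI)
  \<comment> \<open>Additivity gives \<open>0 = (h - h) ^ q = h + (- h) ^ q\<close>,
    whatever the parity of \<open>q\<close>.\<close>
  fix h assume h: "h \<in> {x \<in> carrier R. x [^] (p ^ k) = x}"
  have "(h \<oplus> \<ominus> h) [^] (p ^ k) = \<zero>"
    using h p by (simp add: r_neg nat_pow_zero prime_gt_0_nat)
  then have "h \<oplus> (\<ominus> h) [^] (p ^ k) = \<zero>"
    using h by (simp add: freshmans_dream_power[OF p char])
  then have "(\<ominus> h) [^] (p ^ k) = \<ominus> h"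
    using h by (metis (no_types, lifting) mem_Collect_eq a_inv_closed nat_pow_closed sum_zero_eq_neg a_comm)
  then show "\<ominus> h \<in> {x \<in> carrier R. x [^] (p ^ k) = x}"
    using h by simp
qed (auto simp: nat_pow_distrib freshmans_dream_power[OF p char])

lemma (in field) subfield_frobenius_fixed:
  fixes p :: nat
  assumes p: "Factorial_Ring.prime p" and char: "[p] \<cdot> \<one> = \<zero>"
  shows "subfield {x \<in> carrier R. x [^] (p ^ k) = x} R"
proof (rule subfieldI'[OF subring_frobenius_fixed[OF p char]])
  fix x assume "x \<in> {x \<in> carrier R. x [^] (p ^ k) = x} - {\<zero>}"
  then have x: "x \<in> Units R" "x \<in> carrier R" "x [^] (p ^ k) = x"
    by (simp_all add: field_Units)
  then have "x \<otimes> inv x [^] (p ^ k) = \<one>"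
    by (metis Units_inv_closed Units_r_inv nat_pow_distrib nat_pow_one)
  then show "inv x \<in> {x \<in> carrier R. x [^] (p ^ k) = x}"
    using x comm_inv_char[of x "inv x [^] (p ^ k)"] by simp
qed

section \<open>Existence of finite fields\<close>

text \<open>
  The polynomial \<open>X ^ q - X\<close> for \<open>q \<ge> 2\<close>, as its list of coefficients with the leading one
  first. Spelling out the list makes it evident that a ring homomorphism, applied entrywise, maps
  this polynomial over one ring to the same polynomial over another.
\<close>

definition (in ring) frobenius_poly :: "nat \<Rightarrow> 'a list" where
  "frobenius_poly q = \<one> # replicate (q - 2) \<zero> @ [\<ominus> \<one>, \<zero>]"

lemma (in field) frobenius_poly_closed: "frobenius_poly q \<in> carrier (poly_ring R)"
  unfolding sym[OF univ_poly_carrier] polynomial_def frobenius_poly_def by auto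

lemma (in field) frobenius_poly_eq:
  assumes "2 \<le> q"
  shows "frobenius_poly q = X [^]\<^bsub>poly_ring R\<^esub> q \<ominus>\<^bsub>poly_ring R\<^esub> X"
proof -
  have neg: "\<ominus>\<^bsub>poly_ring R\<^esub> X = [\<ominus> \<one>, \<zero>]"
    using univ_poly_a_inv_def'[OF carrier_is_subring, of X] var_closed(1)[OF carrier_is_subring]
    by (simp add: var_def)
  have "poly_add (monom \<one> q) [\<ominus> \<one>, \<zero>] = frobenius_poly q"
  proof -
    from assms obtain r where r: "q = Suc (Suc r)" by (metis Suc_le_D numeral_2_eq_2 Suc_le_mono)
    have monom: "monom \<one> q = \<one> # replicate r \<zero> @ [\<zero>, \<zero>]"
      by (simp add: monom_def r replicate_append_same replicate_app_Cons_same)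
    have repl: "replicate (q - 1) \<zero> @ [\<ominus> \<one>, \<zero>] = \<zero> # replicate r \<zero> @ [\<ominus> \<one>, \<zero>]"
      by (simp add: r)
    have "map2 (\<oplus>) (monom \<one> q) (replicate (q - 1) \<zero> @ [\<ominus> \<one>, \<zero>]) = frobenius_poly q"
      unfolding monom repl frobenius_poly_def by (simp add: r zip_replicate1)
    then show ?thesis by (simp add: frobenius_poly_def monom_def r)
  qed
  then show ?thesis
    by (simp add: a_minus_def neg univ_poly_add unitary_monom_eq_var_pow[OF carrier_is_subring, symmetric])
qed

lemma (in field) eval_frobenius_poly:
  assumes "2 \<le> q" and a: "a \<in> carrier R"
  shows "eval (frobenius_poly q) a = a [^] q \<ominus> a"
proof -
  interpret UP: domain "poly_ring R"
    using univ_poly_is_domain[OF carrier_is_subring] .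
  interpret ev: ring_hom_ring "poly_ring R" R "\<lambda>p. eval p a"
    by (rule eval_ring_hom[OF carrier_is_subring a])
  have X: "X \<in> carrier (poly_ring R)"
    using var_closed(1)[OF carrier_is_subring] .
  show ?thesis
    using X a by (simp add: frobenius_poly_eq[OF assms(1)] a_minus_def UP.minus_eq
        ev.hom_nat_pow eval_var del: eval.simps)
qed

lemma (in abelian_group) add_minus_add_cancel:
  assumes "x \<in> carrier G" "y \<in> carrier G" "z \<in> carrier G"
  shows "(x \<oplus> z) \<ominus> (y \<oplus> z) = x \<ominus> y"
proof -
  have "(x \<oplus> z) \<ominus> (y \<oplus> z) = x \<oplus> (z \<oplus> (\<ominus> z \<oplus> \<ominus> y))"
    using assms by (simp add: minus_eq minus_add a_assoc a_comm)
  then show ?thesis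
    using assms by (simp add: minus_eq r_neg2)
qed

text \<open>
  All roots of \<open>X ^ q - X\<close> are simple. Instead of the derivative, this uses Frobenius in the
  polynomial ring: if \<open>a ^ q = a\<close> and \<open>T = X - a\<close>, then \<open>X = T + a\<close> gives
  \<open>X ^ q - X = T ^ q - T\<close>. Were \<open>T ^ 2\<close> a divisor of this, it would divide \<open>T\<close>, as it
  divides \<open>T ^ q\<close>; the degrees forbid that.
\<close>

lemma (in field) alg_mult_frobenius_poly_le:
  fixes p :: nat
  assumes p: "Factorial_Ring.prime p" and char: "[p] \<cdot> \<one> = \<zero>" and k: "0 < k"
    and a: "a \<in> carrier R" "a [^] (p ^ k) = a"
  shows "alg_mult (frobenius_poly (p ^ k)) a \<le> 1"
proof (rule ccontr)
  define q where "q = p ^ k"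
  have "p ^ 1 \<le> p ^ k"
    using p k by (intro power_increasing) (auto simp: prime_gt_0_nat Suc_leI)
  then have q: "2 \<le> q"
    using prime_ge_2_nat[OF p] by (simp add: q_def)
  let ?P = "poly_ring R"
  interpret UP: domain ?P
    using univ_poly_is_domain[OF carrier_is_subring] .
  interpret const: ring_hom_ring R ?P poly_of_const
    using canonical_embedding_ring_hom[OF carrier_is_subring] by simp
  define T where "T = [\<one>, \<ominus> a]"
  define c where "c = poly_of_const a"
  let ?f = "frobenius_poly q"
  have T: "T \<in> carrier ?P" "T \<noteq> []"
    using a unfolding sym[OF univ_poly_carrier] polynomial_def T_def by auto
  have c: "c \<in> carrier ?P"
    using a by (simp add: c_def)
  have X: "X = T \<oplus>\<^bsub>?P\<^esub> c"
    using a by (cases "a = \<zero>") (simp_all add: var_def T_def c_def poly_of_const_def univ_poly_add l_neg)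
  have charP: "[p] \<cdot>\<^bsub>?P\<^esub> \<one>\<^bsub>?P\<^esub> = \<zero>\<^bsub>?P\<^esub>"
    using const.hom_add_nat_pow[OF one_closed, of p] char by simp
  \<comment> \<open>Constants form a copy of the field in the polynomial ring, so \<open>c\<close> inherits \<open>a ^ q = a\<close>.\<close>
  have cq: "c [^]\<^bsub>?P\<^esub> q = c"
    using a const.hom_nat_pow[of a q] by (simp add: c_def q_def)
  have "?f = (T [^]\<^bsub>?P\<^esub> q \<oplus>\<^bsub>?P\<^esub> c) \<ominus>\<^bsub>?P\<^esub> (T \<oplus>\<^bsub>?P\<^esub> c)"
    unfolding frobenius_poly_eq[OF q] X
    using UP.freshmans_dream_power[OF p charP T(1) c, of k] by (simp add: q_def[symmetric] cq)
  also have "\<dots> = T [^]\<^bsub>?P\<^esub> q \<ominus>\<^bsub>?P\<^esub> T"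
    using T c by (intro UP.add_minus_add_cancel) auto
  finally have f: "?f = T [^]\<^bsub>?P\<^esub> q \<ominus>\<^bsub>?P\<^esub> T" .
  then have T_eq: "T = T [^]\<^bsub>?P\<^esub> q \<ominus>\<^bsub>?P\<^esub> ?f"
    using T by (simp add: UP.minus_eq UP.minus_add UP.r_neg2)
  \<comment> \<open>A multiplicity of at least \<open>2\<close> makes \<open>T ^ 2\<close> divide \<open>f\<close>, and \<open>q \<ge> 2\<close> makes it divide \<open>T ^ q\<close>.\<close>
  assume "\<not> alg_mult (frobenius_poly (p ^ k)) a \<le> 1"
  then have "T [^]\<^bsub>?P\<^esub> (2::nat) pdivides ?f"
    using le_alg_mult_imp_pdivides[OF a(1) frobenius_poly_closed, of 2 q] by (simp add: q_def T_def)
  moreover have "T [^]\<^bsub>?P\<^esub> (2::nat) pdivides T [^]\<^bsub>?P\<^esub> q"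
    using polynomial_pow_division[OF T(1) q] .
  ultimately have "T [^]\<^bsub>?P\<^esub> (2::nat) pdivides T"
  proof -
    assume "T [^]\<^bsub>?P\<^esub> (2::nat) pdivides ?f" "T [^]\<^bsub>?P\<^esub> (2::nat) pdivides T [^]\<^bsub>?P\<^esub> q"
    then obtain r s where rs: "r \<in> carrier ?P" "s \<in> carrier ?P"
      and "?f = T [^]\<^bsub>?P\<^esub> (2::nat) \<otimes>\<^bsub>?P\<^esub> r" "T [^]\<^bsub>?P\<^esub> q = T [^]\<^bsub>?P\<^esub> (2::nat) \<otimes>\<^bsub>?P\<^esub> s"
      by (auto simp: pdivides_def factor_def)
    with T_eq T have "T = T [^]\<^bsub>?P\<^esub> (2::nat) \<otimes>\<^bsub>?P\<^esub> (s \<ominus>\<^bsub>?P\<^esub> r)"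
      by (simp add: UP.minus_eq UP.r_distr UP.r_minus)
    with rs show ?thesis
      by (auto simp: pdivides_def factor_def)
  qed
  then have "degree (T [^]\<^bsub>?P\<^esub> (2::nat)) \<le> degree T"
    using T by (intro pdivides_imp_degree_le[OF carrier_is_subring]) auto
  moreover have "degree (T [^]\<^bsub>?P\<^esub> (2::nat)) = 2 * degree T"
    using polynomial_pow_degree[OF T(1)] .
  ultimately show False by (simp add: T_def)
qed

text \<open>
  The fixed elements are the roots of \<open>X ^ q - X\<close>. There are \<open>q\<close> of them counted with
  multiplicity because the polynomial splits, and the multiplicities are all \<open>1\<close>.
\<close>

lemma (in field) card_frobenius_fixed:
  fixes p :: nat
  assumes p: "Factorial_Ring.prime p" and char: "[p] \<cdot> \<one> = \<zero>" and k: "0 < k"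
    and split: "splitted (frobenius_poly (p ^ k))"
  shows "card {x \<in> carrier R. x [^] (p ^ k) = x} = p ^ k"
proof -
  have "p ^ 1 \<le> p ^ k"
    using p k by (intro power_increasing) (auto simp: prime_gt_0_nat Suc_leI)
  then have q: "2 \<le> p ^ k"
    using prime_ge_2_nat[OF p] by simp
  let ?f = "frobenius_poly (p ^ k)"
  have nonzero: "?f \<noteq> []" by (simp add: frobenius_poly_def)
  have root: "x \<in># roots ?f \<longleftrightarrow> x \<in> carrier R \<and> x [^] (p ^ k) = x" for x
    using roots_mem_iff_is_root[OF frobenius_poly_closed] eval_frobenius_poly[OF q] nonzero
    by (auto simp: is_root_def)
  then have set: "set_mset (roots ?f) = {x \<in> carrier R. x [^] (p ^ k) = x}"
    by auto
  have count: "count (roots ?f) x = 1" if "x \<in># roots ?f" for x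
  proof -
    have "count (roots ?f) x \<le> 1"
      using alg_mult_frobenius_poly_le[OF p char k] that root
      by (simp add: alg_mult_eq_count_roots[OF frobenius_poly_closed, symmetric])
    with that show ?thesis
      by (metis One_nat_def Suc_leI count_greater_zero_iff le_antisym)
  qed
  have "size (roots ?f) = (\<Sum>x\<in>set_mset (roots ?f). 1)"
    unfolding size_multiset_overloaded_eq by (rule sum.cong) (simp_all add: count)
  then have "card (set_mset (roots ?f)) = size (roots ?f)" by simp
  also have "\<dots> = degree ?f" using split by (simp add: splitted_def)
  also have "\<dots> = p ^ k" using q by (simp add: frobenius_poly_def)
  finally show ?thesis unfolding set .
qed

text \<open>
  Take an extension \<open>L\<close> of the field of residues modulo \<open>p\<close> over which \<open>X ^ q - X\<close> splits: the
  elements of \<open>L\<close> with \<open>x ^ q = x\<close> are the wanted field. Its carrier type is that of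
  the elements of \<open>L\<close>, which are certain indexed polynomials over the residues.
\<close>

theorem exists_finite_field:
  assumes "primepow q"
  shows "\<exists>F :: ((int list \<times> nat) multiset \<Rightarrow> int) ring. field F \<and> card (carrier F) = q"
proof -
  from assms obtain p k where p: "Factorial_Ring.prime p" and k: "0 < k" and q: "q = p ^ k"
    by (auto simp: primepow_def)
  interpret Zp: residues_prime p "residue_ring (int p)"
    by unfold_locales (use p in auto)
  obtain L where L: "L \<in> Zp.extensions"
    and split: "\<And>f. f \<in> carrier (poly_ring (residue_ring (int p))) \<Longrightarrow> ring.splitted L (Zp.\<sigma> f)"
    using Zp.exists_extension_with_roots by blast
  interpret L: field L using L by (simp add: Zp.extensions_def)
  interpret h: ring_hom_ring "residue_ring (int p)" L Zp.indexed_const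
    using L by (intro ring_hom_ringI2 Zp.ring_axioms L.ring_axioms) (simp add: Zp.extensions_def)
  have "[n] \<cdot>\<^bsub>residue_ring (int p)\<^esub> \<one>\<^bsub>residue_ring (int p)\<^esub> = int n mod int p" for n :: nat
    by (induction n) (simp_all add: Zp.res_zero_eq Zp.res_one_eq Zp.res_add_eq mod_simps add.commute)
  then have "[p] \<cdot>\<^bsub>L\<^esub> \<one>\<^bsub>L\<^esub> = \<zero>\<^bsub>L\<^esub>"
    using h.hom_add_nat_pow[OF Zp.one_closed, of p] by (simp add: Zp.res_zero_eq[symmetric])
  moreover have "Zp.\<sigma> (Zp.frobenius_poly q) = L.frobenius_poly q"
    by (simp add: Zp.\<sigma>_def Zp.frobenius_poly_def L.frobenius_poly_def)
  ultimately show ?thesis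
    using split[OF Zp.frobenius_poly_closed, of q] p k q
      L.card_frobenius_fixed[of p k] L.subfield_iff(2)[OF L.subfield_frobenius_fixed[of p k]]
    by (intro exI[of _ "L\<lparr>carrier := {x \<in> carrier L. x [^]\<^bsub>L\<^esub> q = x}\<rparr>"]) simp
qed

section \<open>Prime ideals of prescribed order and index\<close>

lemma card_carrier_ZFact:
  assumes "0 < m"
  shows "card (carrier (ZFact (int m))) = m"
proof -
  have "carrier (ZFact (int m)) = range (ZMod (int m))"
    by (auto simp: ZFact_def FactRing_def A_RCOSETS_def' ZMod_def)
  also have "\<dots> = ZMod (int m) ` {0..<int m}"
  proof (intro equalityI subsetI)
    fix I assume "I \<in> range (ZMod (int m))"
    then obtain a where "I = ZMod (int m) (a mod int m)"
      using ZMod_mod by auto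
    then show "I \<in> ZMod (int m) ` {0..<int m}"
      using assms by auto
  qed auto
  also have "card \<dots> = m"
    by (subst card_image) (auto simp: inj_on_def ZMod_eq_mod)
  finally show ?thesis .
qed

lemma cring_RDirProd:
  assumes "cring R" "cring S"
  shows "cring (RDirProd R S)"
proof -
  interpret R: cring R by fact
  interpret S: cring S by fact
  interpret RS: ring "RDirProd R S"
    by (rule RDirProd_ring[OF R.ring_axioms S.ring_axioms])
  show ?thesis
    by unfold_locales (auto simp: RDirProd_def DirProd_def monoid.defs R.m_comm S.m_comm)
qed

lemma fst_ring_hom: 
  shows "fst \<in> ring_hom (RDirProd R S) R"
  by (auto simp: ring_hom_def RDirProd_def DirProd_def monoid.defs)

text \<open>The ideal is the kernel of the projection onto the domain \<open>F\<close>.\<close>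

lemma primeideal_RDirProd:
  assumes "domain F" "cring S"
  shows "primeideal ({\<zero>\<^bsub>F\<^esub>} \<times> carrier S) (RDirProd F S)"
proof -
  interpret F: domain F by fact
  interpret S: cring S by fact
  interpret FS: cring "RDirProd F S"
    by (rule cring_RDirProd[OF F.cring_axioms assms(2)])
  interpret fst: ring_hom_ring "RDirProd F S" F fst
    by (intro ring_hom_ringI2 fst_ring_hom FS.ring_axioms F.ring_axioms)
  have "{r \<in> carrier (RDirProd F S). fst r \<in> {\<zero>\<^bsub>F\<^esub>}} = {\<zero>\<^bsub>F\<^esub>} \<times> carrier S"
    by (auto simp: RDirProd_carrier)
  then show ?thesis
    using fst.primeideal_vimage[OF FS.cring_axioms F.zeroprimeideal] by simp
qed

text \<open>
  Any injection of the finite carrier into the natural numbers transports the ring structure; the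
  prime ideal is transported as a preimage under the inverse isomorphism.
\<close>

lemma finite_cring_primeideal_nat_copy:
  fixes R :: "('a, 'b) ring_scheme"
  assumes "cring R" "finite (carrier R)" "primeideal P R"
  shows "\<exists>(R' :: nat ring) P'. cring R' \<and> primeideal P' R' \<and>
    card (carrier R') = card (carrier R) \<and> card P' = card P"
proof -
  interpret R: cring R by fact
  interpret P: primeideal P R by fact
  obtain f :: "'a \<Rightarrow> nat" where f: "inj_on f (carrier R)"
    using finite_imp_inj_to_nat_seg[OF assms(2)] by blast
  let ?S = "image_ring f R" 
  let ?g = "inv_into (carrier R) f"
  have iso: "f \<in> ring_iso R ?S" 
    by (rule inj_imp_image_ring_iso[OF f])
  have "cring (?S\<lparr>zero := f \<zero>\<^bsub>R\<^esub>\<rparr>)"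
    by (rule R.ring_iso_imp_img_cring[OF iso])
  then interpret S: cring ?S
    by (simp add: image_ring_def image_group_def monoid.defs)
  have "?g \<in> ring_iso ?S R"
    by (rule ring_iso_set_sym[OF R.ring_axioms iso])
  then interpret g: ring_hom_ring ?S R ?g
    by (intro ring_hom_ringI2 S.ring_axioms R.ring_axioms) (simp add: ring_iso_def)
  have "primeideal {x \<in> carrier ?S. ?g x \<in> P} ?S"
    by (rule g.primeideal_vimage[OF S.cring_axioms assms(3)])
  also have "{x \<in> carrier ?S. ?g x \<in> P} = f ` P"
    using f P.Icarr by (auto simp: image_ring_carrier intro!: image_eqI)
  finally have "primeideal (f ` P) ?S" .
  moreover have "card (f ` P) = card P"
    using f P.Icarr by (intro card_image) (auto intro: inj_on_subset)
  moreover have "card (carrier ?S) = card (carrier R)"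
    using f by (simp add: image_ring_carrier card_image)
  ultimately show ?thesis
    using S.cring_axioms by blast
qed

text \<open>
  The ring is \<open>F \<times> \<int>/m\<close> with \<open>F\<close> a field of order \<open>q\<close>, and the ideal is \<open>0 \<times> \<int>/m\<close>. For
  \<open>m = 1\<close> the second factor is the zero ring, so the construction needs no special case.
\<close>

lemma exists_primeideal_card:
  assumes q: "primepow q" and m: "0 < m"
  shows "\<exists>(R :: nat ring) P. cring R \<and> finite (carrier R) \<and> primeideal P R \<and>
    card P = m \<and> card (carrier R) = q * m"
proof -
  obtain F :: "((int list \<times> nat) multiset \<Rightarrow> int) ring"
    where F: "field F" "card (carrier F) = q"
    using exists_finite_field[OF q] by blast
  interpret F: field F by fact
  let ?Z = "ZFact (int m)"
  let ?R = "RDirProd F ?Z"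
  let ?P = "{\<zero>\<^bsub>F\<^esub>} \<times> carrier ?Z"
  have R: "cring ?R"
    by (rule cring_RDirProd[OF F.cring_axioms ZFact_is_cring])
  have P: "primeideal ?P ?R"
    by (rule primeideal_RDirProd[OF F.domain_axioms ZFact_is_cring])
  have cards: "card (carrier ?R) = q * m" "card ?P = m"
    using F(2) m by (simp_all add: RDirProd_carrier card_cartesian_product card_carrier_ZFact)
  have "0 < q * m"
    using q m by (simp add: primepow_gt_0_nat)
  then have fin: "finite (carrier ?R)"
    using cards(1) by (metis card.infinite less_irrefl)
  obtain S :: "nat ring" and Q where "cring S" "primeideal Q S"
      "card (carrier S) = q * m" "card Q = m"
    using finite_cring_primeideal_nat_copy[OF R fin P] cards by auto
  moreover from this have "finite (carrier S)"
    using \<open>0 < q * m\<close> by (metis card.infinite less_irrefl)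
  ultimately show ?thesis by blast
qed

section \<open>The prime ideal graph as a join\<close>

text \<open>
  By primality \<open>x y \<in> P\<close> holds exactly if \<open>x \<in> P\<close> or \<open>y \<in> P\<close>. So the nonzero elements of \<open>P\<close>
  are adjacent to everything, and no two elements outside \<open>P\<close> are adjacent. Hence any two
  enumerations of \<open>P - {0}\<close> and of the complement of \<open>P\<close> combine to an isomorphism.
\<close>

lemma prime_ideal_graph_iso_join:
  assumes "cring R" "finite (carrier R)" "primeideal P R"
  shows "graph_iso (prime_ideal_graph R P)
      (graph_join (complete_graph (card P - 1)) (edgeless_graph (card (carrier R) - card P)))"
    (is "graph_iso ?G ?H")
proof -
  interpret R: cring R by fact
  interpret P: primeideal P R by fact
  have Psub: "P \<subseteq> carrier R" by (rule P.a_subset)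
  have fin: "finite P" using Psub assms(2) by (rule finite_subset)
  have zero: "\<zero>\<^bsub>R\<^esub> \<in> P" by (rule P.zero_closed)
  have "card (P - {\<zero>\<^bsub>R\<^esub>}) = card P - 1"
    using fin zero by simp
  then obtain f where f: "bij_betw f (P - {\<zero>\<^bsub>R\<^esub>}) {..<card P - 1}"
    using fin by (metis ex_bij_betw_finite_nat finite_Diff atLeast0LessThan)
  have "card (carrier R - P) = card (carrier R) - card P"
    using fin Psub by (rule card_Diff_subset)
  then obtain g where g: "bij_betw g (carrier R - P) {..<card (carrier R) - card P}"
    using assms(2) by (metis ex_bij_betw_finite_nat finite_Diff atLeast0LessThan)
  define h where "h x = (if x \<in> P then Inl (f x) else Inr (g x))" for x
  have "bij_betw h ((P - {\<zero>\<^bsub>R\<^esub>}) \<union> (carrier R - P))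
      (Inl ` {..<card P - 1} \<union> Inr ` {..<card (carrier R) - card P})"
  proof (rule bij_betw_combine)
    show "bij_betw h (P - {\<zero>\<^bsub>R\<^esub>}) (Inl ` {..<card P - 1})"
      using f by (auto simp: h_def bij_betw_def inj_on_def image_image image_iff)
    show "bij_betw h (carrier R - P) (Inr ` {..<card (carrier R) - card P})"
      using g by (auto simp: h_def bij_betw_def inj_on_def)
  qed auto
  moreover have "(P - {\<zero>\<^bsub>R\<^esub>}) \<union> (carrier R - P) = pverts ?G"
    using Psub zero by (auto simp: prime_ideal_graph_def)
  moreover have "Inl ` {..<card P - 1} \<union> Inr ` {..<card (carrier R) - card P} = pverts ?H"
    by (auto simp: graph_join_def complete_graph_def edgeless_graph_def)
  ultimately have bij: "bij_betw h (pverts ?G) (pverts ?H)" by simp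
  have prod: "x \<otimes>\<^bsub>R\<^esub> y \<in> P \<longleftrightarrow> x \<in> P \<or> y \<in> P" if "x \<in> carrier R" "y \<in> carrier R" for x y
    using that P.I_prime P.I_l_closed P.I_r_closed by blast
  have adj: "(h x, h y) \<in> parcs ?H \<longleftrightarrow> (x, y) \<in> parcs ?G"
    if "x \<in> pverts ?G" "y \<in> pverts ?G" for x y
    using that f g prod[of x y]
    by (auto simp: h_def prime_ideal_graph_def graph_join_def complete_graph_def edgeless_graph_def
        dest: bij_betw_imp_inj_on bij_betwE inj_onD)
  show ?thesis
    unfolding graph_iso_iff[OF pair_graph_prime_ideal_graph[OF assms(1,2)]
        pair_graph_graph_join[OF pair_graph_complete_graph pair_graph_edgeless_graph]]
    using bij adj by blast
qed

theorem theorem2p4: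
  fixes q m :: nat
  assumes "primepow q" and "m \<ge> 1"
  shows "\<exists>(R :: nat ring) P.
    cring R \<and> finite (carrier R) \<and> primeideal P R \<and>
    card P = m \<and> card (carrier (R Quot P)) = q \<and>
    graph_iso (prime_ideal_graph R P)
      (graph_join (complete_graph (m - 1)) (edgeless_graph (m * (q - 1))))"
proof -
  obtain R :: "nat ring" and P where R: "cring R" "finite (carrier R)" "primeideal P R"
    and P: "card P = m" and card_R: "card (carrier R) = q * m"
    using exists_primeideal_card[OF assms(1), of m] assms(2) by auto
  interpret R: cring R by fact
  interpret P: primeideal P R by fact
  have "card (a_rcosets\<^bsub>R\<^esub> P) * m = q * m"
    using R.a_lagrange[OF R(2) P.additive_subgroup_axioms] P card_R by (simp add: order_def)
  then have "card (carrier (R Quot P)) = q"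
    using assms(2) by (simp add: FactRing_def)
  moreover have "card (carrier R) - card P = m * (q - 1)"
    by (simp add: card_R P diff_mult_distrib2 mult.commute)
  then have "graph_iso (prime_ideal_graph R P)
      (graph_join (complete_graph (m - 1)) (edgeless_graph (m * (q - 1))))"
    using prime_ideal_graph_iso_join[OF R] P by simp
  ultimately show ?thesis
    using R P by blast
qed

end
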